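(* The reduction relation $\to_{\Lambda M}$ on the set of objects of the $\Lambda M$-calculus is confluent: if $o\to^*_{\Lambda M}o_1$ and $o\to^*_{\Lambda M}o_2$, then there is an object $o_3$ with $o_1\to^*_{\Lambda M}o_3$ and $o_2\to^*_{\Lambda M}o_3$.
   Context: **Syntax of $\Lambda M$.** Fix countably infinite sets of variables $x,y,\dots$ and names $\alpha,\beta,\dots$. Objects $o$ are terms, commands or stacks: terms $t,u,v ::= x \mid t\,u \mid \lambda x.t \mid \mu\alpha.c \mid t[x\backslash u]$ (explicit substitution); commands $c ::= [\alpha]t \mid c[\![\alpha\backslash^{\alpha'}s]\!]$ (explicit replacement, $\alpha\neq\alpha'$); stacks $s ::= \epsilon \mid t\cdot s$. $\lambda x$ binds $x$ in $t$; $\mu\alpha$ binds $\alpha$ in $c$; $t[x\backslash u]$ binds $x$ in $t$ (not in $u$); $c[\![\alpha\backslash^{\alpha'}s]\!]$ binds $\alpha$ in $c$ (not in $s$), and $\alpha'$ is a free name occurrence in it; $[\alpha]t$ contains a free occurrence of $\alpha$. $\mathrm{fv}(o),\mathrm{fn}(o)$ are the free variables and free names. Objects are taken modulo $\alpha$-conversion. Stack concatenation $s\cdot s'$ is associative with neutral element $\epsilon$; the stack $u\cdot\epsilon$ is also written $u$. For a term $u$ and a stack $s=t_1\cdots t_n$ ($n\ge 0$), $u::s$ is the term $u\,t_1\dots t_n$. A context $\mathtt O$ is an object with exactly one hole (standing for a term, $\Box$, or for a command, $\boxdot$); $\mathtt O[o]$ is $\mathtt O$ with the hole filled by $o$ (capture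 allowed). An object $o$ is *free for* $\mathtt O$ if no bound variable or name of $\mathtt O$ is free in $o$. **Meta-operations.** $o\{x\backslash u\}$ is capture-avoiding substitution. For $\alpha\notin \mathrm{fn}(s)$, the (capture-avoiding) replacement $o\{\alpha\backslash^{\alpha'}s\}$, abbreviated $o^\star$ in this paragraph, commutes with all constructors except: $([\alpha]t)^\star=[\alpha'](t^\star::s)$; $(c[\![\gamma\backslash^{\alpha}\epsilon]\!])^\star=c^\star[\![\gamma\backslash^{\beta}s]\!][\![\beta\backslash^{\alpha'}\epsilon]\!]$ if $s\ne\epsilon$, with $\beta$ fresh; $(c[\![\gamma\backslash^{\alpha}\epsilon]\!])^\star=c^\star[\![\gamma\backslash^{\alpha'}\epsilon]\!]$ if $s=\epsilon$; $(c[\![\gamma\backslash^{\alpha}s']\!])^\star=c^\star[\![\gamma\backslash^{\alpha'}s'^\star\cdot s]\!]$ if $s'\neq\epsilon$. (So $([\beta]t)^\star=[\beta]t^\star$ and $(c[\![\gamma\backslash^{\beta}s']\!])^\star=c^\star[\![\gamma\backslash^{\beta}s'^\star]\!]$ for $\beta\ne\alpha$, $\epsilon^\star=\epsilon$, etc.) **Reduction.** Substitution contexts: $\mathtt L::=\Box\mid \mathtt L[x\backslash t]$. $\to_{\Lambda M}$ is the closure under all contexts of the rules (B) $\mathtt L[\lambda x.t]\,u\mapsto \mathtt L[t[x\backslash u]]$, with $u$ free for $\mathtt L$; (S) $t[x\backslash u]\mapsto t\{x\backslash u\}$; (M) $\mathtt L[\mu\alpha.c]\,u\mapsto\mathtt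 L[\mu\alpha'.c[\![\alpha\backslash^{\alpha'}u]\!]]$, with $u$ free for $\mathtt L$ and $\alpha'$ fresh (not occurring in $c,u,\mathtt L$, and $\alpha'\ne\alpha$); (R) $c[\![\alpha\backslash^{\alpha'}s]\!]\mapsto c\{\alpha\backslash^{\alpha'}s\}$. $\to^*_{\Lambda M}$ is the reflexive-transitive closure. *)

theory Defs
  imports Main
begin

text \<open>
  Objects modulo \<open>\<alpha>\<close>-conversion are represented with de Bruijn indices, using two independent
  index spaces, one for variables and one for names. \<^const>\<open>Suc\<close> and \<open>0\<close> below refer to the
  space of the binder at hand:
  \<^item> \<open>Lam t\<close> is \<open>\<lambda>x.t\<close> and \<open>ESub t u\<close> is \<open>t[x\u]\<close>; both bind variable \<open>0\<close> in \<open>t\<close> only;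
  \<^item> \<open>Mu c\<close> is \<open>\<mu>\<alpha>.c\<close> and binds name \<open>0\<close> in \<open>c\<close>;
  \<^item> \<open>Named a t\<close> is \<open>[a]t\<close>;
  \<^item> \<open>ERepl c a s\<close> is the explicit replacement of \<open>\<alpha>\<close> in \<open>c\<close> by \<open>a\<close> with stack \<open>s\<close>;
    it binds name \<open>0\<close> (that is \<open>\<alpha>\<close>) in \<open>c\<close> only, and \<open>a\<close> is an index of the surrounding scope,
    so that \<open>\<alpha>\<close> and \<open>a\<close> are distinct by construction.

  Stacks are lists: \<open>\<epsilon>\<close> is \<open>[]\<close> and concatenation is \<open>@\<close>.
\<close>

datatype trm =
    Var nat
  | App trm trm
  | Lam trm
  | Mu cmd
  | ESub trm trm
and cmd =
    Named nat trm
  | ERepl cmd nat "trm list"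

type_synonym stack = "trm list"

datatype obj = OTrm trm | OCmd cmd | OStk stack

definition lift_idx :: "nat \<Rightarrow> nat \<Rightarrow> nat" where
  "lift_idx k i = (if i < k then i else Suc i)"

text \<open>
  \<open>vlift_t k\<close> and \<open>nlift_t k\<close> (with their versions for commands) make room for a fresh variable,
  respectively a fresh name, at index \<open>k\<close>.
\<close>

primrec vlift_t :: "nat \<Rightarrow> trm \<Rightarrow> trm" and vlift_c :: "nat \<Rightarrow> cmd \<Rightarrow> cmd" where
  "vlift_t k (Var i) = Var (lift_idx k i)"
| "vlift_t k (App t u) = App (vlift_t k t) (vlift_t k u)"
| "vlift_t k (Lam t) = Lam (vlift_t (Suc k) t)"
| "vlift_t k (Mu c) = Mu (vlift_c k c)"
| "vlift_t k (ESub t u) = ESub (vlift_t (Suc k) t) (vlift_t k u)"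
| "vlift_c k (Named a t) = Named a (vlift_t k t)"
| "vlift_c k (ERepl c a s) = ERepl (vlift_c k c) a (map (vlift_t k) s)"

primrec nlift_t :: "nat \<Rightarrow> trm \<Rightarrow> trm" and nlift_c :: "nat \<Rightarrow> cmd \<Rightarrow> cmd" where
  "nlift_t k (Var i) = Var i"
| "nlift_t k (App t u) = App (nlift_t k t) (nlift_t k u)"
| "nlift_t k (Lam t) = Lam (nlift_t k t)"
| "nlift_t k (Mu c) = Mu (nlift_c (Suc k) c)"
| "nlift_t k (ESub t u) = ESub (nlift_t k t) (nlift_t k u)"
| "nlift_c k (Named a t) = Named (lift_idx k a) (nlift_t k t)"
| "nlift_c k (ERepl c a s) = ERepl (nlift_c (Suc k) c) (lift_idx k a) (map (nlift_t k) s)"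

text \<open>
  \<open>subst_t k u t\<close> is \<open>t{x\u}\<close> where \<open>x\<close> has index \<open>k\<close>. The scope of \<open>x\<close> disappears: larger
  indices of \<open>t\<close> are decremented, and \<open>u\<close> lives outside that scope.
\<close>

primrec subst_t :: "nat \<Rightarrow> trm \<Rightarrow> trm \<Rightarrow> trm" and subst_c :: "nat \<Rightarrow> trm \<Rightarrow> cmd \<Rightarrow> cmd" where
  "subst_t k u (Var i) = (if i < k then Var i else if i = k then u else Var (i - 1))"
| "subst_t k u (App t v) = App (subst_t k u t) (subst_t k u v)"
| "subst_t k u (Lam t) = Lam (subst_t (Suc k) (vlift_t 0 u) t)"
| "subst_t k u (Mu c) = Mu (subst_c k (nlift_t 0 u) c)"
| "subst_t k u (ESub t v) = ESub (subst_t (Suc k) (vlift_t 0 u) t) (subst_t k u v)"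
| "subst_c k u (Named a t) = Named a (subst_t k u t)"
| "subst_c k u (ERepl c a s) = ERepl (subst_c k (nlift_t 0 u) c) a (map (subst_t k u) s)"

text \<open>The term written \<open>u :: s\<close> on paper, i.e. \<open>u\<close> applied successively to the elements of \<open>s\<close>.\<close>

definition apps :: "trm \<Rightarrow> stack \<Rightarrow> trm" where
  "apps u s = foldl App u s"

definition drop_idx :: "nat \<Rightarrow> nat \<Rightarrow> nat" where
  "drop_idx k i = (if i < k then i else i - 1)"

text \<open>
  \<open>repl_c k a s c\<close> replaces the name \<open>\<alpha>\<close> of index \<open>k\<close> by \<open>a\<close> with stack \<open>s\<close> in \<open>c\<close>. As for
  substitution, the scope of \<open>\<alpha>\<close> disappears and \<open>a\<close>, \<open>s\<close> live outside it; hence \<open>\<alpha>\<close> does not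
  occur in \<open>s\<close>. In the third case of the clause for \<^const>\<open>ERepl\<close>, the result has a new
  outer binder \<open>\<beta>\<close>, which is index \<open>1\<close> below the binder already present and index \<open>0\<close> in the
  inner target and stack.
\<close>

primrec repl_t :: "nat \<Rightarrow> nat \<Rightarrow> stack \<Rightarrow> trm \<Rightarrow> trm"
  and repl_c :: "nat \<Rightarrow> nat \<Rightarrow> stack \<Rightarrow> cmd \<Rightarrow> cmd" where
  "repl_t k a s (Var i) = Var i"
| "repl_t k a s (App t u) = App (repl_t k a s t) (repl_t k a s u)"
| "repl_t k a s (Lam t) = Lam (repl_t k a (map (vlift_t 0) s) t)"
| "repl_t k a s (Mu c) = Mu (repl_c (Suc k) (Suc a) (map (nlift_t 0) s) c)"
| "repl_t k a s (ESub t u) = ESub (repl_t k a (map (vlift_t 0) s) t) (repl_t k a s u)"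
| "repl_c k a s (Named b t) =
     (if b = k then Named a (apps (repl_t k a s t) s)
      else Named (drop_idx k b) (repl_t k a s t))"
| "repl_c k a s (ERepl c b s') =
     (let c' = repl_c (Suc k) (Suc a) (map (nlift_t 0) s) c;
          s'' = map (repl_t k a s) s'
      in if b \<noteq> k then ERepl c' (drop_idx k b) s''
         else if s' \<noteq> [] then ERepl c' a (s'' @ s)
         else if s \<noteq> [] then ERepl (ERepl (nlift_c 1 c') 0 (map (nlift_t 0) s)) a []
         else ERepl c' a [])"

text \<open>Substitution contexts; \<open>sdepth L\<close> is the number of variables bound at the hole.\<close>

datatype sctx = Hole | CSub sctx trm

primrec fill :: "sctx \<Rightarrow> trm \<Rightarrow> trm" where
  "fill Hole t = t"
| "fill (CSub L u) t = ESub (fill L t) u"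

primrec sdepth :: "sctx \<Rightarrow> nat" where
  "sdepth Hole = 0"
| "sdepth (CSub L u) = Suc (sdepth L)"

text \<open>
  Moving \<open>u\<close> under \<open>L\<close> without capture (\<open>u\<close> free for \<open>L\<close>) is lifting by \<open>sdepth L\<close>. In rule \<open>M\<close>
  the fresh name \<open>\<alpha>'\<close> is bound by the new \<^const>\<open>Mu\<close>: it has index \<open>1\<close> in the body of the
  explicit replacement, where \<open>0\<close> is \<open>\<alpha>\<close>, and index \<open>0\<close> in its target and stack.
\<close>

inductive red_t :: "trm \<Rightarrow> trm \<Rightarrow> bool"
  and red_c :: "cmd \<Rightarrow> cmd \<Rightarrow> bool"
  and red_s :: "stack \<Rightarrow> stack \<Rightarrow> bool" where
  B: "red_t (App (fill L (Lam t)) u) (fill L (ESub t ((vlift_t 0 ^^ sdepth L) u)))"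
| S: "red_t (ESub t u) (subst_t 0 u t)"
| M: "red_t (App (fill L (Mu c)) u)
        (fill L (Mu (ERepl (nlift_c 1 c) 0 [nlift_t 0 ((vlift_t 0 ^^ sdepth L) u)])))"
| R: "red_c (ERepl c a s) (repl_c 0 a s c)"
| App_left: "red_t t t' \<Longrightarrow> red_t (App t u) (App t' u)"
| App_right: "red_t u u' \<Longrightarrow> red_t (App t u) (App t u')"
| Lam: "red_t t t' \<Longrightarrow> red_t (Lam t) (Lam t')"
| Mu: "red_c c c' \<Longrightarrow> red_t (Mu c) (Mu c')"
| ESub_left: "red_t t t' \<Longrightarrow> red_t (ESub t u) (ESub t' u)"
| ESub_right: "red_t u u' \<Longrightarrow> red_t (ESub t u) (ESub t u')"
| Named: "red_t t t' \<Longrightarrow> red_c (Named a t) (Named a t')"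
| ERepl_cmd: "red_c c c' \<Longrightarrow> red_c (ERepl c a s) (ERepl c' a s)"
| ERepl_stack: "red_s s s' \<Longrightarrow> red_c (ERepl c a s) (ERepl c a s')"
| Stack_head: "red_t t t' \<Longrightarrow> red_s (t # s) (t' # s)"
| Stack_tail: "red_s s s' \<Longrightarrow> red_s (t # s) (t # s')"

inductive red :: "obj \<Rightarrow> obj \<Rightarrow> bool" (infix \<open>\<rightarrow>\<^sub>\<Lambda>\<^sub>M\<close> 50) where
  "red_t t t' \<Longrightarrow> OTrm t \<rightarrow>\<^sub>\<Lambda>\<^sub>M OTrm t'"
| "red_c c c' \<Longrightarrow> OCmd c \<rightarrow>\<^sub>\<Lambda>\<^sub>M OCmd c'"
| "red_s s s' \<Longrightarrow> OStk s \<rightarrow>\<^sub>\<Lambda>\<^sub>M OStk s'"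

abbreviation reds :: "obj \<Rightarrow> obj \<Rightarrow> bool" (infix \<open>\<rightarrow>\<^sup>*\<^sub>\<Lambda>\<^sub>M\<close> 50) where
  "p \<rightarrow>\<^sup>*\<^sub>\<Lambda>\<^sub>M q \<equiv> red\<^sup>*\<^sup>* p q"

end

theory Submission
  imports Defs "HOL-Library.Confluence"
begin

text \<open>
  Confluence is pulled back from the \<open>\<lambda>\<mu>\<close>-calculus. Carrying out all explicit operators of an
  object \<open>o\<close> gives an object \<open>nf o\<close> without explicit operators, and \<open>o\<close> reduces to \<open>nf o\<close>.
  A step by rule \<open>S\<close> or \<open>R\<close> does not change \<open>nf o\<close>, and a step by rule \<open>B\<close> or \<open>M\<close> becomes a
  parallel \<open>\<lambda>\<mu>\<close>-step. Parallel \<open>\<lambda>\<mu>\<close>-reduction has the diamond property (Takahashi's complete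
  developments) and is simulated by the original reduction, so a common parallel reduct of
  \<open>nf o\<^sub>1\<close> and \<open>nf o\<^sub>2\<close> joins \<open>o\<^sub>1\<close> and \<open>o\<^sub>2\<close>.

  The detour matters: two replacements commute only up to reduction in the presence of explicit
  replacements with empty stack, so that a step \<open>c \<rightarrow> c'\<close> need not give a reduction from
  \<open>c{\<alpha>\<^sup>a s}\<close> to \<open>c'{\<alpha>\<^sup>a s}\<close>; on objects without explicit operators they commute on the nose.
\<close>

subsection \<open>Simultaneous substitution and replacement\<close>

lemma lift_idx_simps [simp]:
  "lift_idx 0 i = Suc i" "lift_idx (Suc k) 0 = 0" "lift_idx (Suc k) (Suc i) = Suc (lift_idx k i)"
  by (auto simp: lift_idx_def)

lemma drop_idx_Suc [simp]:
  "drop_idx (Suc k) 0 = 0" "i \<noteq> k \<Longrightarrow> drop_idx (Suc k) (Suc i) = Suc (drop_idx k i)"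
  by (auto simp: drop_idx_def)

lemma lift_idx_lift_idx: "k \<le> j \<Longrightarrow> lift_idx (Suc j) (lift_idx k i) = lift_idx k (lift_idx j i)"
  by (auto simp: lift_idx_def)

lemma vlift_vlift:
  "k \<le> j \<Longrightarrow> vlift_t (Suc j) (vlift_t k t) = vlift_t k (vlift_t j t)"
  "k \<le> j \<Longrightarrow> vlift_c (Suc j) (vlift_c k c) = vlift_c k (vlift_c j c)"
  by (induct t and c arbitrary: k j and k j) (auto simp: lift_idx_lift_idx)

lemma nlift_nlift:
  "k \<le> j \<Longrightarrow> nlift_t (Suc j) (nlift_t k t) = nlift_t k (nlift_t j t)"
  "k \<le> j \<Longrightarrow> nlift_c (Suc j) (nlift_c k c) = nlift_c k (nlift_c j c)"
  by (induct t and c arbitrary: k j and k j) (auto simp: lift_idx_lift_idx)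

lemma vlift_nlift:
  "vlift_t k (nlift_t j t) = nlift_t j (vlift_t k t)"
  "vlift_c k (nlift_c j c) = nlift_c j (vlift_c k c)"
  by (induct t and c arbitrary: k j and k j) auto

lemma apps_simps [simp]: "apps t [] = t" "apps t (u # s) = apps (App t u) s"
  by (simp_all add: apps_def)

lemma apps_append: "apps t (s @ s') = apps (apps t s) s'"
  by (simp add: apps_def)

lemma vlift_apps: "vlift_t k (apps t s) = apps (vlift_t k t) (map (vlift_t k) s)"
  by (induct s arbitrary: t) auto

lemma nlift_apps: "nlift_t k (apps t s) = apps (nlift_t k t) (map (nlift_t k) s)"
  by (induct s arbitrary: t) auto

section \<open>Evaluation in environments and its fusion law\<close>

type_synonym venv = "nat \<Rightarrow> trm"
type_synonym nenv = "nat \<Rightarrow> nat \<times> stack"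

definition vlift_nenv :: "nat \<Rightarrow> nenv \<Rightarrow> nenv" where
  "vlift_nenv k \<rho> a = (fst (\<rho> a), map (vlift_t k) (snd (\<rho> a)))"

definition nlift_nenv :: "nat \<Rightarrow> nenv \<Rightarrow> nenv" where
  "nlift_nenv k \<rho> a = (lift_idx k (fst (\<rho> a)), map (nlift_t k) (snd (\<rho> a)))"

text \<open>
  The environment \<open>\<rho>\<close> sends a name to a target name and a stack. Since both kinds of explicit
  operators merely extend the environment, the results contain none of them (unless \<open>\<sigma>\<close> or \<open>\<rho>\<close>
  does).
\<close>

primrec eval_t :: "venv \<Rightarrow> nenv \<Rightarrow> trm \<Rightarrow> trm" and eval_c :: "venv \<Rightarrow> nenv \<Rightarrow> cmd \<Rightarrow> cmd" where
  "eval_t \<sigma> \<rho> (Var i) = \<sigma> i"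
| "eval_t \<sigma> \<rho> (App t u) = App (eval_t \<sigma> \<rho> t) (eval_t \<sigma> \<rho> u)"
| "eval_t \<sigma> \<rho> (Lam t) = Lam (eval_t (case_nat (Var 0) (vlift_t 0 \<circ> \<sigma>)) (vlift_nenv 0 \<rho>) t)"
| "eval_t \<sigma> \<rho> (Mu c) = Mu (eval_c (nlift_t 0 \<circ> \<sigma>) (case_nat (0, []) (nlift_nenv 0 \<rho>)) c)"
| "eval_t \<sigma> \<rho> (ESub t u) = eval_t (case_nat (eval_t \<sigma> \<rho> u) \<sigma>) \<rho> t"
| "eval_c \<sigma> \<rho> (Named a t) = Named (fst (\<rho> a)) (apps (eval_t \<sigma> \<rho> t) (snd (\<rho> a)))"
| "eval_c \<sigma> \<rho> (ERepl c a s) =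
     eval_c \<sigma> (case_nat (fst (\<rho> a), map (eval_t \<sigma> \<rho>) s @ snd (\<rho> a)) \<rho>) c"

lemma case_nat_comp_lift_idx [simp]:
  "case_nat x f \<circ> lift_idx (Suc k) = case_nat x (f \<circ> lift_idx k)"
  "case_nat x f \<circ> lift_idx 0 = f"
  by (auto simp: fun_eq_iff lift_idx_def split: nat.split)

lemma comp_case_nat [simp]: "f \<circ> case_nat x g = case_nat (f x) (f \<circ> g)"
  by (auto simp: fun_eq_iff split: nat.split)

lemma lift_nenv_comp [simp]:
  "vlift_nenv k \<rho> \<circ> f = vlift_nenv k (\<rho> \<circ> f)"
  "nlift_nenv k \<rho> \<circ> f = nlift_nenv k (\<rho> \<circ> f)"
  by (auto simp: fun_eq_iff vlift_nenv_def nlift_nenv_def)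

lemma eval_vlift:
  "eval_t \<sigma> \<rho> (vlift_t k t) = eval_t (\<sigma> \<circ> lift_idx k) \<rho> t"
  "eval_c \<sigma> \<rho> (vlift_c k c) = eval_c (\<sigma> \<circ> lift_idx k) \<rho> c"
  by (induct t and c arbitrary: \<sigma> \<rho> k and \<sigma> \<rho> k) (auto simp: comp_assoc cong: map_cong)

lemma eval_nlift:
  "eval_t \<sigma> \<rho> (nlift_t k t) = eval_t \<sigma> (\<rho> \<circ> lift_idx k) t"
  "eval_c \<sigma> \<rho> (nlift_c k c) = eval_c \<sigma> (\<rho> \<circ> lift_idx k) c"
  by (induct t and c arbitrary: \<sigma> \<rho> k and \<sigma> \<rho> k) (auto simp: comp_assoc cong: map_cong)

lemma lift_nenv_case_nat [simp]:
  "vlift_nenv k (case_nat p \<rho>) = case_nat (fst p, map (vlift_t k) (snd p)) (vlift_nenv k \<rho>)"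
  "nlift_nenv k (case_nat p \<rho>) =
     case_nat (lift_idx k (fst p), map (nlift_t k) (snd p)) (nlift_nenv k \<rho>)"
  by (auto simp: fun_eq_iff vlift_nenv_def nlift_nenv_def split: nat.split)

lemma lift_comp_lift:
  "vlift_t (Suc k) \<circ> (vlift_t 0 \<circ> \<sigma>) = vlift_t 0 \<circ> (vlift_t k \<circ> \<sigma>)"
  "vlift_t k \<circ> (nlift_t 0 \<circ> \<sigma>) = nlift_t 0 \<circ> (vlift_t k \<circ> \<sigma>)"
  "nlift_t (Suc k) \<circ> (nlift_t 0 \<circ> \<sigma>) = nlift_t 0 \<circ> (nlift_t k \<circ> \<sigma>)"
  "nlift_t k \<circ> (vlift_t 0 \<circ> \<sigma>) = vlift_t 0 \<circ> (nlift_t k \<circ> \<sigma>)"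
  by (auto simp: fun_eq_iff vlift_vlift nlift_nlift vlift_nlift)

lemma lift_nenv_lift_nenv:
  "vlift_nenv (Suc k) (vlift_nenv 0 \<rho>) = vlift_nenv 0 (vlift_nenv k \<rho>)"
  "vlift_nenv k (nlift_nenv 0 \<rho>) = nlift_nenv 0 (vlift_nenv k \<rho>)"
  "nlift_nenv (Suc k) (nlift_nenv 0 \<rho>) = nlift_nenv 0 (nlift_nenv k \<rho>)"
  "nlift_nenv k (vlift_nenv 0 \<rho>) = vlift_nenv 0 (nlift_nenv k \<rho>)"
  by (auto simp: fun_eq_iff vlift_nenv_def nlift_nenv_def vlift_vlift nlift_nlift vlift_nlift)

lemma fst_snd_vlift_nenv [simp]:
  "fst (vlift_nenv k \<rho> a) = fst (\<rho> a)" "snd (vlift_nenv k \<rho> a) = map (vlift_t k) (snd (\<rho> a))"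
  by (simp_all add: vlift_nenv_def)

lemma fst_snd_nlift_nenv [simp]:
  "fst (nlift_nenv k \<rho> a) = lift_idx k (fst (\<rho> a))"
  "snd (nlift_nenv k \<rho> a) = map (nlift_t k) (snd (\<rho> a))"
  by (simp_all add: nlift_nenv_def)

lemma vlift_eval:
  "vlift_t k (eval_t \<sigma> \<rho> t) = eval_t (vlift_t k \<circ> \<sigma>) (vlift_nenv k \<rho>) t"
  "vlift_c k (eval_c \<sigma> \<rho> c) = eval_c (vlift_t k \<circ> \<sigma>) (vlift_nenv k \<rho>) c"
  by (induct t and c arbitrary: \<sigma> \<rho> k and \<sigma> \<rho> k)
    (auto simp: vlift_apps lift_comp_lift lift_nenv_lift_nenv cong: map_cong)

lemma nlift_eval:
  "nlift_t k (eval_t \<sigma> \<rho> t) = eval_t (nlift_t k \<circ> \<sigma>) (nlift_nenv k \<rho>) t"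
  "nlift_c k (eval_c \<sigma> \<rho> c) = eval_c (nlift_t k \<circ> \<sigma>) (nlift_nenv k \<rho>) c"
  by (induct t and c arbitrary: \<sigma> \<rho> k and \<sigma> \<rho> k)
    (auto simp: nlift_apps lift_comp_lift lift_nenv_lift_nenv cong: map_cong)

lemma eval_apps: "eval_t \<sigma> \<rho> (apps t s) = apps (eval_t \<sigma> \<rho> t) (map (eval_t \<sigma> \<rho>) s)"
  by (induct s arbitrary: t) auto

text \<open>A name is looked up in \<open>\<rho>'\<close> and its target in \<open>\<rho>\<close>.
  The stack from \<open>\<rho>'\<close> comes first because its arguments are already applied when
  \<open>\<rho>\<close> adds its own.\<close>

definition nenv_comp :: "venv \<Rightarrow> nenv \<Rightarrow> nenv \<Rightarrow> nenv" where
  "nenv_comp \<sigma> \<rho> \<rho>' a =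
     (fst (\<rho> (fst (\<rho>' a))), map (eval_t \<sigma> \<rho>) (snd (\<rho>' a)) @ snd (\<rho> (fst (\<rho>' a))))"

lemma fst_snd_nenv_comp [simp]:
  "fst (nenv_comp \<sigma> \<rho> \<rho>' a) = fst (\<rho> (fst (\<rho>' a)))"
  "snd (nenv_comp \<sigma> \<rho> \<rho>' a) = map (eval_t \<sigma> \<rho>) (snd (\<rho>' a)) @ snd (\<rho> (fst (\<rho>' a)))"
  by (simp_all add: nenv_comp_def)

lemma nenv_comp_case_nat [simp]:
  "nenv_comp \<sigma> \<rho> (case_nat p \<rho>') =
     case_nat (fst (\<rho> (fst p)), map (eval_t \<sigma> \<rho>) (snd p) @ snd (\<rho> (fst p))) (nenv_comp \<sigma> \<rho> \<rho>')"
  by (auto simp: fun_eq_iff nenv_comp_def split: nat.split)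

lemma eval_vlift_0:
  "eval_t (case_nat x \<sigma>) \<rho> (vlift_t 0 t) = eval_t \<sigma> \<rho> t"
  "eval_t (case_nat x \<sigma>) \<rho> \<circ> vlift_t 0 = eval_t \<sigma> \<rho>"
  by (simp_all add: eval_vlift fun_eq_iff)

lemma eval_nlift_0:
  "eval_t \<sigma> (case_nat p \<rho>) (nlift_t 0 t) = eval_t \<sigma> \<rho> t"
  "eval_t \<sigma> (case_nat p \<rho>) \<circ> nlift_t 0 = eval_t \<sigma> \<rho>"
  by (simp_all add: eval_nlift fun_eq_iff)

text \<open>These identities carry the composite environments of \<open>eval_eval\<close> under
  \<open>Lam\<close> and \<open>Mu\<close>, where both environments are lifted.\<close>

lemma eval_comp_vlift:
  "eval_t (case_nat x (vlift_t 0 \<circ> \<sigma>)) (vlift_nenv 0 \<rho>) \<circ> (vlift_t 0 \<circ> \<sigma>') =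
     vlift_t 0 \<circ> (eval_t \<sigma> \<rho> \<circ> \<sigma>')"
  "eval_t (nlift_t 0 \<circ> \<sigma>) (case_nat p (nlift_nenv 0 \<rho>)) \<circ> (nlift_t 0 \<circ> \<sigma>') =
     nlift_t 0 \<circ> (eval_t \<sigma> \<rho> \<circ> \<sigma>')"
  "nenv_comp (case_nat x (vlift_t 0 \<circ> \<sigma>)) (vlift_nenv 0 \<rho>) (vlift_nenv 0 \<rho>') =
     vlift_nenv 0 (nenv_comp \<sigma> \<rho> \<rho>')"
  "nenv_comp (nlift_t 0 \<circ> \<sigma>) (case_nat p (nlift_nenv 0 \<rho>)) (nlift_nenv 0 \<rho>') =
     nlift_nenv 0 (nenv_comp \<sigma> \<rho> \<rho>')"
  by (auto simp: fun_eq_iff eval_vlift_0 eval_nlift_0 vlift_eval nlift_eval nenv_comp_def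
      vlift_nenv_def nlift_nenv_def intro!: arg_cong2[of _ _ _ _ "\<lambda>f g. eval_t f g _"])

text \<open>Explicit operators only extend the environment, so their cases follow from
  \<open>comp_case_nat\<close> and \<open>nenv_comp_case_nat\<close>; a named term collects both
  stacks by \<open>apps_append\<close>.\<close>

lemma eval_eval:
  "eval_t \<sigma> \<rho> (eval_t \<sigma>' \<rho>' t) = eval_t (eval_t \<sigma> \<rho> \<circ> \<sigma>') (nenv_comp \<sigma> \<rho> \<rho>') t"
  "eval_c \<sigma> \<rho> (eval_c \<sigma>' \<rho>' c) = eval_c (eval_t \<sigma> \<rho> \<circ> \<sigma>') (nenv_comp \<sigma> \<rho> \<rho>') c"
  by (induct t and c arbitrary: \<sigma> \<rho> \<sigma>' \<rho>' and \<sigma> \<rho> \<sigma>' \<rho>')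
    (auto simp: eval_apps apps_append eval_comp_vlift cong: map_cong)

section \<open>Invariance of values under substitution and replacement\<close>

text \<open>The lifts of \<open>u\<close> under binders cancel against the extended environment, so
  the induction works for arbitrary \<open>k\<close>. At \<open>k = 0\<close> the environment is the
  one used for \<open>ESub\<close>, hence rule \<open>S\<close> preserves values.\<close>

lemma eval_subst:
  "eval_t \<sigma> \<rho> (subst_t k u t) =
     eval_t (\<lambda>i. if i = k then eval_t \<sigma> \<rho> u else \<sigma> (drop_idx k i)) \<rho> t"
  "eval_c \<sigma> \<rho> (subst_c k u c) =
     eval_c (\<lambda>i. if i = k then eval_t \<sigma> \<rho> u else \<sigma> (drop_idx k i)) \<rho> c"
proof (induct t and c arbitrary: \<sigma> \<rho> k u and \<sigma> \<rho> k u)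
  case (Var i)
  then show ?case by (auto simp: drop_idx_def)
next
  case (Lam t)
  show ?case
    by (auto simp: Lam fun_eq_iff eval_vlift_0 vlift_eval
        intro!: arg_cong2[of _ _ _ _ "\<lambda>f g. eval_t f g _"] split: nat.split)
next
  case (Mu c)
  show ?case
    by (auto simp: Mu fun_eq_iff eval_nlift_0 nlift_eval
        intro!: arg_cong2[of _ _ _ _ "\<lambda>f g. eval_c f g _"] split: nat.split)
next
  case (ESub t v)
  show ?case
    by (auto simp: ESub fun_eq_iff eval_vlift_0
        intro!: arg_cong2[of _ _ _ _ "\<lambda>f g. eval_t f g _"] split: nat.split)
next
  case (ERepl c a s)
  then show ?case
    by (auto simp: ERepl eval_nlift_0 cong: map_cong if_cong)
qed auto

text \<open>The different outcomes of \<open>repl_c\<close> on an explicit replacement all evaluate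
  its body in the same environment. At \<open>k = 0\<close> this is the environment used for
  \<open>ERepl\<close>, hence rule \<open>R\<close> preserves values.\<close>

lemma eval_repl:
  "eval_t \<sigma> \<rho> (repl_t k a s t) =
     eval_t \<sigma> (\<lambda>b. if b = k then (fst (\<rho> a), map (eval_t \<sigma> \<rho>) s @ snd (\<rho> a)) else \<rho> (drop_idx k b)) t"
  "eval_c \<sigma> \<rho> (repl_c k a s c) =
     eval_c \<sigma> (\<lambda>b. if b = k then (fst (\<rho> a), map (eval_t \<sigma> \<rho>) s @ snd (\<rho> a)) else \<rho> (drop_idx k b)) c"
proof (induct t and c arbitrary: \<sigma> \<rho> k a s and \<sigma> \<rho> k a s)
  case (Lam t)
  show ?case
    by (auto simp: Lam fun_eq_iff eval_vlift_0 vlift_eval vlift_nenv_def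
        intro!: arg_cong2[of _ _ _ _ "\<lambda>f g. eval_t f g _"] split: nat.split)
next
  case (Mu c)
  show ?case
    by (auto simp: Mu fun_eq_iff eval_nlift_0 nlift_eval nlift_nenv_def
        intro!: arg_cong2[of _ _ _ _ "\<lambda>f g. eval_c f g _"] split: nat.split)
next
  case (ESub t v)
  show ?case
    by (simp add: ESub eval_vlift_0 cong: if_cong)
next
  case (Named b t)
  show ?case
    by (auto simp: Named eval_apps apps_append)
next
  case (ERepl c b s')
  let ?\<rho> = "\<lambda>b. if b = k then (fst (\<rho> a), map (eval_t \<sigma> \<rho>) s @ snd (\<rho> a)) else \<rho> (drop_idx k b)"
  let ?c = "repl_c (Suc k) (Suc a) (map (nlift_t 0) s) c"
  have stack: "map (eval_t \<sigma> \<rho>) (map (repl_t k a s) s') = map (eval_t \<sigma> ?\<rho>) s'"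
    using ERepl(2) by simp
  \<comment> \<open>The entry \<open>p\<close> belongs to the name bound in \<open>c\<close>; it
    stays arbitrary because the clauses supply different entries. The lifts of \<open>a\<close> and
    \<open>s\<close> cancel against it.\<close>
  have cmd: "eval_c \<sigma> (case_nat p \<rho>) ?c = eval_c \<sigma> (case_nat p ?\<rho>) c" for p
    by (auto simp: ERepl(1) fun_eq_iff eval_nlift_0
        intro!: arg_cong2[of _ _ _ _ "\<lambda>f g. eval_c f g _"] split: nat.split)
  consider "b \<noteq> k" | "b = k" "s' \<noteq> []" | "b = k" "s' = []" "s \<noteq> []" | "b = k" "s' = []" "s = []"
    by blast
  then show ?case
  proof cases
    case 1
    have "eval_c \<sigma> \<rho> (repl_c k a s (ERepl c b s')) =
        eval_c \<sigma> (case_nat (fst (\<rho> (drop_idx k b)), map (eval_t \<sigma> \<rho>) (map (repl_t k a s) s') @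
          snd (\<rho> (drop_idx k b))) \<rho>) ?c"
      using 1 by (simp add: Let_def)
    with 1 show ?thesis unfolding cmd stack by simp
  next
    case 2
    have "eval_c \<sigma> \<rho> (repl_c k a s (ERepl c b s')) =
        eval_c \<sigma> (case_nat (fst (\<rho> a), map (eval_t \<sigma> \<rho>) (map (repl_t k a s) s') @
          map (eval_t \<sigma> \<rho>) s @ snd (\<rho> a)) \<rho>) ?c"
      using 2 by (simp add: Let_def)
    with 2 show ?thesis unfolding cmd stack by simp
  next
    case 3
    \<comment> \<open>The outer replacement gives the new name the entry \<open>\<rho> a\<close>,
      and the inner one prepends \<open>s\<close>; \<open>nlift_c 1\<close> makes the body skip the
      new name.\<close>
    have "eval_c \<sigma> \<rho> (repl_c k a s (ERepl c b s')) =
        eval_c \<sigma> (case_nat (fst (\<rho> a), map (eval_t \<sigma> \<rho>) s @ snd (\<rho> a)) \<rho>) ?c"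
      using 3 by (simp add: Let_def eval_nlift eval_nlift_0)
    with 3 show ?thesis unfolding cmd by simp
  next
    case 4
    have "eval_c \<sigma> \<rho> (repl_c k a s (ERepl c b s')) = eval_c \<sigma> (case_nat (\<rho> a) \<rho>) ?c"
      using 4 by (simp add: Let_def)
    with 4 show ?thesis unfolding cmd by simp
  qed
qed auto


section \<open>Values in the identity environment and explicit-free objects\<close>

definition idn :: nenv where
  "idn a = (a, [])"

lemma fst_snd_idn [simp]: "fst (idn a) = a" "snd (idn a) = []"
  by (simp_all add: idn_def)

lemma lift_nenv_idn [simp]:
  "vlift_nenv k idn = idn" "idn \<circ> lift_idx k = nlift_nenv k idn"
  "case_nat (0, []) (nlift_nenv 0 idn) = idn"
  by (auto simp: fun_eq_iff idn_def vlift_nenv_def nlift_nenv_def split: nat.split)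

lemma lift_comp_Var [simp]:
  "nlift_t k \<circ> Var = Var" "vlift_t k \<circ> Var = Var \<circ> lift_idx k"
  "case_nat (Var 0) (Var \<circ> lift_idx 0) = Var"
  by (auto simp: fun_eq_iff split: nat.split)

lemma nenv_comp_idn [simp]: "nenv_comp \<sigma> \<rho> idn = \<rho>"
  by (auto simp: fun_eq_iff nenv_comp_def)

lemma eval_comp_Var [simp]: "eval_t \<sigma> \<rho> \<circ> Var = \<sigma>"
  by (auto simp: fun_eq_iff)

text \<open>The identity environment is neutral for the fusion law, so parts of an object may be
  normalised before it is evaluated.\<close>

lemma eval_nf:
  "eval_t \<sigma> \<rho> (eval_t Var idn t) = eval_t \<sigma> \<rho> t"
  "eval_c \<sigma> \<rho> (eval_c Var idn c) = eval_c \<sigma> \<rho> c"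
  by (simp_all add: eval_eval)

primrec expl_free_t :: "trm \<Rightarrow> bool" and expl_free_c :: "cmd \<Rightarrow> bool" where
  "expl_free_t (Var i) = True"
| "expl_free_t (App t u) = (expl_free_t t \<and> expl_free_t u)"
| "expl_free_t (Lam t) = expl_free_t t"
| "expl_free_t (Mu c) = expl_free_c c"
| "expl_free_t (ESub t u) = False"
| "expl_free_c (Named a t) = expl_free_t t"
| "expl_free_c (ERepl c a s) = False"

lemma eval_Var_idn:
  "expl_free_t t \<Longrightarrow> eval_t Var idn t = t"
  "expl_free_c c \<Longrightarrow> eval_c Var idn c = c"
  by (induct t and c) auto

lemma expl_free_vlift [simp]:
  "expl_free_t (vlift_t k t) = expl_free_t t"
  "expl_free_c (vlift_c k c) = expl_free_c c"
  by (induct t and c arbitrary: k and k) auto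

lemma expl_free_nlift [simp]:
  "expl_free_t (nlift_t k t) = expl_free_t t"
  "expl_free_c (nlift_c k c) = expl_free_c c"
  by (induct t and c arbitrary: k and k) auto

lemma expl_free_apps [simp]: "expl_free_t (apps t s) = (expl_free_t t \<and> list_all expl_free_t s)"
  by (induct s arbitrary: t) auto

lemma expl_free_subst:
  "expl_free_t t \<Longrightarrow> expl_free_t u \<Longrightarrow> expl_free_t (subst_t k u t)"
  "expl_free_c c \<Longrightarrow> expl_free_t u \<Longrightarrow> expl_free_c (subst_c k u c)"
  by (induct t and c arbitrary: k u and k u) auto

lemma expl_free_repl:
  "expl_free_t t \<Longrightarrow> list_all expl_free_t s \<Longrightarrow> expl_free_t (repl_t k a s t)"
  "expl_free_c c \<Longrightarrow> list_all expl_free_t s \<Longrightarrow> expl_free_c (repl_c k a s c)"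
  by (induct t and c arbitrary: k a s and k a s) (auto simp: list.pred_map o_def)

definition expl_free_env :: "venv \<Rightarrow> nenv \<Rightarrow> bool" where
  "expl_free_env \<sigma> \<rho> \<longleftrightarrow> (\<forall>i. expl_free_t (\<sigma> i)) \<and> (\<forall>a. list_all expl_free_t (snd (\<rho> a)))"

lemma expl_free_env_simps [simp]:
  "expl_free_env (vlift_t 0 \<circ> \<sigma>) (vlift_nenv 0 \<rho>) = expl_free_env \<sigma> \<rho>"
  "expl_free_env (nlift_t 0 \<circ> \<sigma>) (nlift_nenv 0 \<rho>) = expl_free_env \<sigma> \<rho>"
  "expl_free_env (case_nat u \<sigma>) \<rho> = (expl_free_t u \<and> expl_free_env \<sigma> \<rho>)"
  "expl_free_env \<sigma> (case_nat p \<rho>) = (list_all expl_free_t (snd p) \<and> expl_free_env \<sigma> \<rho>)"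
  "expl_free_env Var idn"
  by (auto simp: expl_free_env_def list.pred_map o_def split: nat.splits)

text \<open>The object itself may contain explicit operators: their clauses merely extend the
  environment with explicit-free values.\<close>

lemma expl_free_eval:
  "expl_free_env \<sigma> \<rho> \<Longrightarrow> expl_free_t (eval_t \<sigma> \<rho> t)"
  "expl_free_env \<sigma> \<rho> \<Longrightarrow> expl_free_c (eval_c \<sigma> \<rho> c)"
proof (induct t and c arbitrary: \<sigma> \<rho> and \<sigma> \<rho>)
  case (Named a t)
  then show ?case by (auto simp: expl_free_env_def)
next
  case (ERepl c a s)
  then show ?case by (auto simp: expl_free_env_def list_all_iff intro!: ERepl split: nat.split)
next
  case (Var i)
  then show ?case by (simp add: expl_free_env_def)
qed simp_all

subsection \<open>Parallel reduction of the \<open>\<lambda>\<mu>\<close>-calculus\<close>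

text \<open>Contraction of a beta redex, written as an evaluation so that the fusion law
  applies.\<close>

definition inst :: "trm \<Rightarrow> trm \<Rightarrow> trm" where
  "inst u = eval_t (case_nat u Var) idn"

text \<open>Structural substitution of the \<open>\<lambda>\<mu>\<close>-calculus: name
  \<open>0\<close> keeps its index, since a new binder replaces the old one, but gains the argument
  \<open>u\<close>.\<close>

definition minst :: "trm \<Rightarrow> cmd \<Rightarrow> cmd" where
  "minst u = eval_c Var (case_nat (0, [nlift_t 0 u]) (nlift_nenv 0 idn))"

text \<open>Having no rules for \<^const>\<open>ESub\<close> and \<^const>\<open>ERepl\<close>, it only relates objects without them.\<close>

inductive par_t :: "trm \<Rightarrow> trm \<Rightarrow> bool" and par_c :: "cmd \<Rightarrow> cmd \<Rightarrow> bool" where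
  Var: "par_t (Var i) (Var i)"
| App: "par_t t t' \<Longrightarrow> par_t u u' \<Longrightarrow> par_t (App t u) (App t' u')"
| Lam: "par_t t t' \<Longrightarrow> par_t (Lam t) (Lam t')"
| Mu: "par_c c c' \<Longrightarrow> par_t (Mu c) (Mu c')"
| Named: "par_t t t' \<Longrightarrow> par_c (Named a t) (Named a t')"
| Beta: "par_t t t' \<Longrightarrow> par_t u u' \<Longrightarrow> par_t (App (Lam t) u) (inst u' t')"
| Struct: "par_c c c' \<Longrightarrow> par_t u u' \<Longrightarrow> par_t (App (Mu c) u) (Mu (minst u' c'))"

lemma par_expl_free:
  "par_t t t' \<Longrightarrow> expl_free_t t \<and> expl_free_t t'"
  "par_c c c' \<Longrightarrow> expl_free_c c \<and> expl_free_c c'"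
proof (induct rule: par_t_par_c.inducts)
  case (Struct c c' u u')
  have "expl_free_env Var (nlift_nenv 0 idn)"
    by (simp add: expl_free_env_def)
  with Struct show ?case by (auto simp: minst_def intro!: expl_free_eval)
qed (auto simp: inst_def intro!: expl_free_eval)

lemma inst_vlift: "vlift_t k (inst u t) = inst (vlift_t k u) (vlift_t (Suc k) t)"
  by (simp add: inst_def vlift_eval eval_vlift)

lemma inst_nlift: "nlift_t k (inst u t) = inst (nlift_t k u) (nlift_t k t)"
  by (simp add: inst_def nlift_eval eval_nlift)

lemma minst_vlift: "vlift_c k (minst u c) = minst (vlift_t k u) (vlift_c k c)"
  by (simp add: minst_def vlift_eval eval_vlift vlift_nlift lift_nenv_lift_nenv)

lemma minst_nlift: "nlift_c (Suc k) (minst u c) = minst (nlift_t k u) (nlift_c (Suc k) c)"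
  by (simp add: minst_def nlift_eval eval_nlift nlift_nlift lift_nenv_lift_nenv)

lemma par_vlift:
  "par_t t t' \<Longrightarrow> par_t (vlift_t k t) (vlift_t k t')"
  "par_c c c' \<Longrightarrow> par_c (vlift_c k c) (vlift_c k c')"
  by (induct arbitrary: k and k rule: par_t_par_c.inducts)
    (auto simp: inst_vlift minst_vlift intro: par_t_par_c.intros)

lemma par_nlift:
  "par_t t t' \<Longrightarrow> par_t (nlift_t k t) (nlift_t k t')"
  "par_c c c' \<Longrightarrow> par_c (nlift_c k c) (nlift_c k c')"
  by (induct arbitrary: k and k rule: par_t_par_c.inducts)
    (auto simp: inst_nlift minst_nlift intro: par_t_par_c.intros)

lemma par_apps: "par_t t t' \<Longrightarrow> list_all2 par_t s s' \<Longrightarrow> par_t (apps t s) (apps t' s')"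
  by (induct s arbitrary: t t' s') (auto simp: list_all2_Cons1, blast intro: par_t_par_c.intros)

section \<open>Substitutivity of parallel reduction\<close>

definition par_env :: "venv \<Rightarrow> nenv \<Rightarrow> venv \<Rightarrow> nenv \<Rightarrow> bool" where
  "par_env \<sigma> \<rho> \<sigma>' \<rho>' \<longleftrightarrow> (\<forall>i. par_t (\<sigma> i) (\<sigma>' i)) \<and>
     (\<forall>a. fst (\<rho> a) = fst (\<rho>' a) \<and> list_all2 par_t (snd (\<rho> a)) (snd (\<rho>' a)))"

lemma par_envI:
  "par_env \<sigma> \<rho> \<sigma>' \<rho>' \<Longrightarrow> par_env (vlift_t 0 \<circ> \<sigma>) (vlift_nenv 0 \<rho>) (vlift_t 0 \<circ> \<sigma>') (vlift_nenv 0 \<rho>')"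
  "par_env \<sigma> \<rho> \<sigma>' \<rho>' \<Longrightarrow> par_env (nlift_t 0 \<circ> \<sigma>) (nlift_nenv 0 \<rho>) (nlift_t 0 \<circ> \<sigma>') (nlift_nenv 0 \<rho>')"
  "par_t u u' \<Longrightarrow> par_env \<sigma> \<rho> \<sigma>' \<rho>' \<Longrightarrow> par_env (case_nat u \<sigma>) \<rho> (case_nat u' \<sigma>') \<rho>'"
  "list_all2 par_t s s' \<Longrightarrow> par_env \<sigma> \<rho> \<sigma>' \<rho>' \<Longrightarrow> par_env \<sigma> (case_nat (a, s) \<rho>) \<sigma>' (case_nat (a, s') \<rho>')"
  "par_env Var idn Var idn"
  by (auto simp: par_env_def list.rel_map par_vlift par_nlift
      intro: par_t_par_c.intros list_all2_mono[where P = par_t] split: nat.split)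

lemma par_env_expl_free: "par_env \<sigma> \<rho> \<sigma>' \<rho>' \<Longrightarrow> expl_free_env \<sigma>' \<rho>'"
  unfolding par_env_def expl_free_env_def list_all_length list_all2_conv_all_nth
  by (metis par_expl_free(1))

lemma eval_inst: "eval_t \<sigma> \<rho> (inst u t) = eval_t (case_nat (eval_t \<sigma> \<rho> u) \<sigma>) \<rho> t"
  by (simp add: inst_def eval_eval)

text \<open>Fusion turns instantiation of the retained variable \<open>0\<close> into an extension
  of the environment. Explicit-free entries are unchanged by evaluation in the identity
  environment.\<close>

lemma inst_eval:
  assumes "expl_free_env \<sigma> \<rho>"
  shows "inst u (eval_t (case_nat (Var 0) (vlift_t 0 \<circ> \<sigma>)) (vlift_nenv 0 \<rho>) t) =
    eval_t (case_nat u \<sigma>) \<rho> t"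
proof -
  have "eval_t (case_nat u Var) idn \<circ> (vlift_t 0 \<circ> \<sigma>) = \<sigma>"
    using assms by (auto simp: fun_eq_iff expl_free_env_def eval_vlift_0 eval_Var_idn)
  moreover have "nenv_comp (case_nat u Var) idn (vlift_nenv 0 \<rho>) = \<rho>"
    using assms by (auto simp: fun_eq_iff nenv_comp_def expl_free_env_def list_all_iff eval_vlift_0 eval_Var_idn
        intro!: prod_eqI map_idI)
  ultimately show ?thesis
    by (simp add: inst_def eval_eval)
qed

lemma eval_minst:
  "eval_c (nlift_t 0 \<circ> \<sigma>) (case_nat (0, []) (nlift_nenv 0 \<rho>)) (minst u c) =
    eval_c (nlift_t 0 \<circ> \<sigma>) (case_nat (0, [nlift_t 0 (eval_t \<sigma> \<rho> u)]) (nlift_nenv 0 \<rho>)) c"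
proof -
  have "nenv_comp (nlift_t 0 \<circ> \<sigma>) (case_nat (0, []) (nlift_nenv 0 \<rho>)) (nlift_nenv 0 idn) = nlift_nenv 0 \<rho>"
    by (auto simp: fun_eq_iff nenv_comp_def prod_eq_iff)
  then show ?thesis
    by (simp add: minst_def eval_eval eval_nlift_0 nlift_eval)
qed

text \<open>The same for names: the entries of the lifted environment avoid name \<open>0\<close>
  and are explicit-free, so the structural substitution leaves them unchanged.\<close>

lemma minst_eval:
  assumes "expl_free_env \<sigma> \<rho>"
  shows "minst u (eval_c (nlift_t 0 \<circ> \<sigma>) (case_nat (0, []) (nlift_nenv 0 \<rho>)) c) =
    eval_c (nlift_t 0 \<circ> \<sigma>) (case_nat (0, [nlift_t 0 u]) (nlift_nenv 0 \<rho>)) c"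
proof -
  let ?\<rho> = "case_nat (0, [nlift_t 0 u]) (nlift_nenv 0 idn)"
  have nf: "eval_t Var ?\<rho> (nlift_t 0 v) = nlift_t 0 v" if "expl_free_t v" for v
  proof -
    have "eval_t Var ?\<rho> (nlift_t 0 v) = nlift_t 0 (eval_t Var idn v)"
      by (simp add: eval_nlift_0 nlift_eval)
    with that show ?thesis by (simp add: eval_Var_idn)
  qed
  then have "eval_t Var ?\<rho> \<circ> (nlift_t 0 \<circ> \<sigma>) = nlift_t 0 \<circ> \<sigma>"
    using assms by (auto simp: fun_eq_iff expl_free_env_def)
  moreover have "nenv_comp Var ?\<rho> (nlift_nenv 0 \<rho>) = nlift_nenv 0 \<rho>"
    using assms nf by (auto simp: fun_eq_iff nenv_comp_def expl_free_env_def list_all_iff prod_eq_iff)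
  ultimately show ?thesis
    by (simp add: minst_def eval_eval)
qed

text \<open>An evaluated redex is still a redex. By \<open>inst_eval\<close> and
  \<open>minst_eval\<close>, its contractum is the value of the original contractum.\<close>

lemma par_eval:
  "par_t t t' \<Longrightarrow> par_env \<sigma> \<rho> \<sigma>' \<rho>' \<Longrightarrow> par_t (eval_t \<sigma> \<rho> t) (eval_t \<sigma>' \<rho>' t')"
  "par_c c c' \<Longrightarrow> par_env \<sigma> \<rho> \<sigma>' \<rho>' \<Longrightarrow> par_c (eval_c \<sigma> \<rho> c) (eval_c \<sigma>' \<rho>' c')"
proof (induct arbitrary: \<sigma> \<rho> \<sigma>' \<rho>' and \<sigma> \<rho> \<sigma>' \<rho>' rule: par_t_par_c.inducts)
  case (Var i)
  then show ?case by (simp add: par_env_def)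
next
  case (Named t t' a)
  then show ?case by (auto simp: par_env_def intro!: par_t_par_c.intros par_apps)
next
  case (Beta t t' u u')
  then have "par_t (eval_t \<sigma> \<rho> (App (Lam t) u))
      (inst (eval_t \<sigma>' \<rho>' u') (eval_t (case_nat (Var 0) (vlift_t 0 \<circ> \<sigma>')) (vlift_nenv 0 \<rho>') t'))"
    by (auto intro!: par_t_par_c.intros par_envI Beta)
  then show ?case
    by (simp add: eval_inst inst_eval[OF par_env_expl_free[OF Beta(5)]])
next
  case (Struct c c' u u')
  then have "par_t (eval_t \<sigma> \<rho> (App (Mu c) u)) (Mu (minst (eval_t \<sigma>' \<rho>' u')
      (eval_c (nlift_t 0 \<circ> \<sigma>') (case_nat (0, []) (nlift_nenv 0 \<rho>')) c')))"
    by (auto intro!: par_t_par_c.intros par_envI Struct)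
  then show ?case
    by (simp add: eval_minst minst_eval[OF par_env_expl_free[OF Struct(5)]])
next
  case (Lam t t')
  then show ?case by (auto intro!: par_t_par_c.intros par_envI Lam)
next
  case (Mu c c')
  then show ?case by (auto intro!: par_t_par_c.intros par_envI Mu)
qed (auto intro!: par_t_par_c.intros)

text \<open>This is not an instance of \<open>par_eval\<close>: \<open>t\<close> and
  \<open>c\<close> may contain explicit operators, on which parallel reduction is not reflexive.
  Evaluation carries them out on both sides.\<close>

lemma par_eval_env:
  "par_env \<sigma> \<rho> \<sigma>' \<rho>' \<Longrightarrow> par_t (eval_t \<sigma> \<rho> t) (eval_t \<sigma>' \<rho>' t)"
  "par_env \<sigma> \<rho> \<sigma>' \<rho>' \<Longrightarrow> par_c (eval_c \<sigma> \<rho> c) (eval_c \<sigma>' \<rho>' c)"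
proof (induct t and c arbitrary: \<sigma> \<rho> \<sigma>' \<rho>' and \<sigma> \<rho> \<sigma>' \<rho>')
  case (Var i)
  then show ?case by (simp add: par_env_def)
next
  case (Named a t)
  then show ?case by (auto simp: par_env_def intro!: par_t_par_c.intros par_apps)
next
  case (ERepl c a s)
  then have "list_all2 par_t (map (eval_t \<sigma> \<rho>) s @ snd (\<rho> a)) (map (eval_t \<sigma>' \<rho>') s @ snd (\<rho>' a))"
    by (auto simp: par_env_def list.rel_map intro!: list_all2_appendI list.rel_refl_strong ERepl(2))
  with ERepl show ?case by (auto simp: par_env_def intro!: ERepl(1) split: nat.split)
next
  case (Lam t)
  then show ?case by (auto intro!: par_t_par_c.intros par_envI Lam)
next
  case (Mu c)
  then show ?case by (auto intro!: par_t_par_c.intros par_envI Mu)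
next
  case (ESub t u)
  then show ?case by (auto intro!: par_envI ESub)
qed (auto intro!: par_t_par_c.intros)

section \<open>Reduction steps as parallel steps between values\<close>

text \<open>Evaluation dissolves the context \<open>L\<close> into the environment, so a redex at a
  distance becomes an ordinary one.\<close>

lemma par_eval_fill_Lam:
  "par_env \<sigma> \<rho> \<sigma>' \<rho>' \<Longrightarrow> par_t (App (eval_t \<sigma> \<rho> (fill L (Lam t))) (eval_t \<sigma> \<rho> u))
    (eval_t \<sigma>' \<rho>' (fill L (ESub t ((vlift_t 0 ^^ sdepth L) u))))"
proof (induct L arbitrary: \<sigma> \<rho> \<sigma>' \<rho>' u)
  case Hole
  have "par_t (App (eval_t \<sigma> \<rho> (Lam t)) (eval_t \<sigma> \<rho> u))
    (inst (eval_t \<sigma>' \<rho>' u) (eval_t (case_nat (Var 0) (vlift_t 0 \<circ> \<sigma>')) (vlift_nenv 0 \<rho>') t))"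
    using Hole by (auto intro!: par_t_par_c.intros par_eval_env par_envI)
  then show ?case
    by (simp add: inst_eval[OF par_env_expl_free[OF Hole]])
next
  case (CSub L w)
  \<comment> \<open>The entry for \<open>w\<close> extends the environment, so the argument is
    lifted once: \<open>eval_vlift_0\<close> cancels this on the left, and
    \<open>funpow_swap1\<close> matches it with the additional lift from \<open>sdepth\<close> on
    the right.\<close>
  from CSub(1)[OF par_envI(3)[OF par_eval_env(1)[OF CSub(2), of w] CSub(2)], of "vlift_t 0 u"]
  show ?case by (simp add: eval_vlift_0 funpow_swap1)
qed

text \<open>At the hole, evaluating the new explicit replacement adds an entry with target
  \<open>0\<close> and the argument as its stack, which is what \<open>minst\<close> does.\<close>

lemma par_eval_fill_Mu:
  "par_env \<sigma> \<rho> \<sigma>' \<rho>' \<Longrightarrow> par_t (App (eval_t \<sigma> \<rho> (fill L (Mu c))) (eval_t \<sigma> \<rho> u))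
    (eval_t \<sigma>' \<rho>' (fill L (Mu (ERepl (nlift_c 1 c) 0 [nlift_t 0 ((vlift_t 0 ^^ sdepth L) u)]))))"
proof (induct L arbitrary: \<sigma> \<rho> \<sigma>' \<rho>' u)
  case Hole
  have "par_t (App (eval_t \<sigma> \<rho> (Mu c)) (eval_t \<sigma> \<rho> u))
    (Mu (minst (eval_t \<sigma>' \<rho>' u) (eval_c (nlift_t 0 \<circ> \<sigma>') (case_nat (0, []) (nlift_nenv 0 \<rho>')) c)))"
    using Hole by (auto intro!: par_t_par_c.intros par_eval_env par_envI)
  then show ?case
    by (simp add: minst_eval[OF par_env_expl_free[OF Hole]] eval_nlift eval_nlift_0 nlift_eval)
next
  case (CSub L w)
  from CSub(1)[OF par_envI(3)[OF par_eval_env(1)[OF CSub(2), of w] CSub(2)], of "vlift_t 0 u"]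
  show ?case by (simp add: eval_vlift_0 funpow_swap1)
qed

lemma list_all2_par_eval:
  "par_env \<sigma> \<rho> \<sigma>' \<rho>' \<Longrightarrow> list_all2 par_t (map (eval_t \<sigma> \<rho>) s) (map (eval_t \<sigma>' \<rho>') s)"
  by (simp add: list.rel_map list.rel_refl_strong par_eval_env)

text \<open>A step in the second component of \<open>ESub\<close> or in the stack of
  \<open>ERepl\<close> becomes a step in the environment, covered by \<open>par_eval_env\<close>.
  Rules \<open>S\<close> and \<open>R\<close> preserve the value in a given environment.\<close>

lemma red_par_eval:
  "red_t t t' \<Longrightarrow> par_env \<sigma> \<rho> \<sigma>' \<rho>' \<Longrightarrow> par_t (eval_t \<sigma> \<rho> t) (eval_t \<sigma>' \<rho>' t')"
  "red_c c c' \<Longrightarrow> par_env \<sigma> \<rho> \<sigma>' \<rho>' \<Longrightarrow> par_c (eval_c \<sigma> \<rho> c) (eval_c \<sigma>' \<rho>' c')"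
  "red_s s s' \<Longrightarrow> par_env \<sigma> \<rho> \<sigma>' \<rho>' \<Longrightarrow> list_all2 par_t (map (eval_t \<sigma> \<rho>) s) (map (eval_t \<sigma>' \<rho>') s')"
proof (induct arbitrary: \<sigma> \<rho> \<sigma>' \<rho>' and \<sigma> \<rho> \<sigma>' \<rho>' and \<sigma> \<rho> \<sigma>' \<rho>' rule: red_t_red_c_red_s.inducts)
  case (B L t u)
  then show ?case using par_eval_fill_Lam by simp
next
  case (S t u)
  have "eval_t \<sigma>' \<rho>' (subst_t 0 u t) = eval_t \<sigma>' \<rho>' (ESub t u)"
    by (auto simp: eval_subst drop_idx_def fun_eq_iff
        intro!: arg_cong2[of _ _ _ _ "\<lambda>f g. eval_t f g _"] split: nat.split)
  with par_eval_env(1)[OF S] show ?case by metis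
next
  case (M L c u)
  then show ?case using par_eval_fill_Mu by simp
next
  case (R c a s)
  have "eval_c \<sigma>' \<rho>' (repl_c 0 a s c) = eval_c \<sigma>' \<rho>' (ERepl c a s)"
    by (auto simp: eval_repl drop_idx_def fun_eq_iff
        intro!: arg_cong2[of _ _ _ _ "\<lambda>f g. eval_c f g _"] split: nat.split)
  with par_eval_env(2)[OF R] show ?case by metis
next
  case (Named t t' a)
  then show ?case by (auto simp: par_env_def intro!: par_t_par_c.intros par_apps)
next
  case (ERepl_cmd c c' a s)
  then show ?case
    using list_all2_par_eval[OF ERepl_cmd(3), of s]
    by (auto simp: par_env_def list_all2_appendI intro!: ERepl_cmd(2) split: nat.split)
next
  case (ERepl_stack s s' c a)
  then show ?case
    using ERepl_stack(2)[OF ERepl_stack(3)]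
    by (auto simp: par_env_def list_all2_appendI intro!: par_eval_env split: nat.split)
next
  case (Lam t t')
  then show ?case by (auto intro!: par_t_par_c.intros par_envI Lam)
next
  case (Mu c c')
  then show ?case by (auto intro!: par_t_par_c.intros par_envI Mu)
next
  case (ESub_left t t' u)
  then show ?case by (auto intro!: par_envI par_eval_env ESub_left)
qed (auto intro!: par_t_par_c.intros par_envI par_eval_env list_all2_par_eval)

section \<open>Complete developments and the diamond property\<close>

text \<open>The values on \<^const>\<open>ESub\<close> and \<^const>\<open>ERepl\<close> are irrelevant.\<close>

fun dev_t :: "trm \<Rightarrow> trm" and dev_c :: "cmd \<Rightarrow> cmd" where
  "dev_t (Var i) = Var i"
| "dev_t (App (Lam t) u) = inst (dev_t u) (dev_t t)"
| "dev_t (App (Mu c) u) = Mu (minst (dev_t u) (dev_c c))"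
| "dev_t (App t u) = App (dev_t t) (dev_t u)"
| "dev_t (Lam t) = Lam (dev_t t)"
| "dev_t (Mu c) = Mu (dev_c c)"
| "dev_t (ESub t u) = ESub t u"
| "dev_c (Named a t) = Named a (dev_t t)"
| "dev_c (ERepl c a s) = ERepl c a s"

inductive_cases par_LamE: "par_t (Lam t) t'"
inductive_cases par_MuE: "par_t (Mu c) t'"

lemma par_inst: "par_t t t' \<Longrightarrow> par_t u u' \<Longrightarrow> par_t (inst u t) (inst u' t')"
  by (auto simp: inst_def intro!: par_eval par_envI)

lemma par_minst: "par_c c c' \<Longrightarrow> par_t u u' \<Longrightarrow> par_c (minst u c) (minst u' c')"
  unfolding minst_def
  by (rule par_eval) (auto simp: par_env_def par_nlift split: nat.split intro: par_t_par_c.intros)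

lemma par_triangle:
  "par_t t t' \<Longrightarrow> par_t t' (dev_t t)"
  "par_c c c' \<Longrightarrow> par_c c' (dev_c c)"
proof (induct rule: par_t_par_c.inducts)
  case (App t t' u u')
  then show ?case
    \<comment> \<open>The head of \<open>t\<close> selects the clause of \<open>dev_t\<close>. If it
      is \<open>Lam\<close> or \<open>Mu\<close>, inversion shows that \<open>t'\<close> has the
      same head, so the redex is still there and can be contracted now.\<close>
    by (cases t) (auto elim!: par_LamE par_MuE intro: par_t_par_c.intros)
qed (auto intro: par_t_par_c.intros par_inst par_minst)

inductive par :: "obj \<Rightarrow> obj \<Rightarrow> bool" where
  "par_t t t' \<Longrightarrow> par (OTrm t) (OTrm t')"
| "par_c c c' \<Longrightarrow> par (OCmd c) (OCmd c')"
| "list_all2 par_t s s' \<Longrightarrow> par (OStk s) (OStk s')"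

primrec nf :: "obj \<Rightarrow> obj" where
  "nf (OTrm t) = OTrm (eval_t Var idn t)"
| "nf (OCmd c) = OCmd (eval_c Var idn c)"
| "nf (OStk s) = OStk (map (eval_t Var idn) s)"

primrec dev :: "obj \<Rightarrow> obj" where
  "dev (OTrm t) = OTrm (dev_t t)"
| "dev (OCmd c) = OCmd (dev_c c)"
| "dev (OStk s) = OStk (map dev_t s)"

lemma par_dev: "par p q \<Longrightarrow> par q (dev p)"
  by (induct rule: par.induct)
    (auto simp: par_triangle list_all2_conv_all_nth intro!: par.intros)

text \<open>All parallel reducts of \<open>p\<close> step to \<open>dev p\<close>, which closes
  every fork.\<close>

lemma confluentp_par: "confluentp par"
  by (rule strong_confluentp_imp_confluentp, rule strong_confluentpI) (blast dest: par_dev)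

lemma red_par_nf: "p \<rightarrow>\<^sub>\<Lambda>\<^sub>M q \<Longrightarrow> par (nf p) (nf q)"
  by (induct rule: red.induct) (auto intro!: par.intros red_par_eval par_envI)

subsection \<open>Simulation and confluence\<close>

lemma reds_App: "red_t\<^sup>*\<^sup>* t t' \<Longrightarrow> red_t\<^sup>*\<^sup>* u u' \<Longrightarrow> red_t\<^sup>*\<^sup>* (App t u) (App t' u')"
  by (rule rtranclp_trans[of _ _ "App t' u"];
      erule rtranclp_induct; auto intro: red_t_red_c_red_s.intros rtranclp.intros)

lemma reds_ESub: "red_t\<^sup>*\<^sup>* t t' \<Longrightarrow> red_t\<^sup>*\<^sup>* u u' \<Longrightarrow> red_t\<^sup>*\<^sup>* (ESub t u) (ESub t' u')"
  by (rule rtranclp_trans[of _ _ "ESub t' u"];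
      erule rtranclp_induct; auto intro: red_t_red_c_red_s.intros rtranclp.intros)

lemma reds_Lam: "red_t\<^sup>*\<^sup>* t t' \<Longrightarrow> red_t\<^sup>*\<^sup>* (Lam t) (Lam t')"
  by (erule rtranclp_induct; auto intro: red_t_red_c_red_s.intros rtranclp.intros)

lemma reds_Mu: "red_c\<^sup>*\<^sup>* c c' \<Longrightarrow> red_t\<^sup>*\<^sup>* (Mu c) (Mu c')"
  by (erule rtranclp_induct; auto intro: red_t_red_c_red_s.intros rtranclp.intros)

lemma reds_Named: "red_t\<^sup>*\<^sup>* t t' \<Longrightarrow> red_c\<^sup>*\<^sup>* (Named a t) (Named a t')"
  by (erule rtranclp_induct; auto intro: red_t_red_c_red_s.intros rtranclp.intros)

lemma reds_ERepl: "red_c\<^sup>*\<^sup>* c c' \<Longrightarrow> red_s\<^sup>*\<^sup>* s s' \<Longrightarrow> red_c\<^sup>*\<^sup>* (ERepl c a s) (ERepl c' a s')"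
  by (rule rtranclp_trans[of _ _ "ERepl c' a s"];
      erule rtranclp_induct; auto intro: red_t_red_c_red_s.intros rtranclp.intros)

lemma reds_Cons: "red_t\<^sup>*\<^sup>* t t' \<Longrightarrow> red_s\<^sup>*\<^sup>* s s' \<Longrightarrow> red_s\<^sup>*\<^sup>* (t # s) (t' # s')"
  by (rule rtranclp_trans[of _ _ "t' # s"];
      erule rtranclp_induct; auto intro: red_t_red_c_red_s.intros rtranclp.intros)

lemma reds_stack: "list_all2 red_t\<^sup>*\<^sup>* s s' \<Longrightarrow> red_s\<^sup>*\<^sup>* s s'"
  by (induct rule: list_all2_induct) (auto intro: reds_Cons)

text \<open>Inner operators are carried out first; a single step by \<open>S\<close> or
  \<open>R\<close> on explicit-free parts then gives an explicit-free result.\<close>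

lemma reds_nf_t_c:
  "red_t\<^sup>*\<^sup>* t (eval_t Var idn t)"
  "red_c\<^sup>*\<^sup>* c (eval_c Var idn c)"
proof (induct t and c)
  case (ESub t u)
  let ?r = "subst_t 0 (eval_t Var idn u) (eval_t Var idn t)"
  have "red_t\<^sup>*\<^sup>* (ESub t u) ?r"
    using reds_ESub[OF ESub] by (auto intro: S rtranclp.rtrancl_into_rtrancl)
  \<comment> \<open>An explicit-free term is its own value. With evaluation outermost,
    \<open>eval_subst\<close> and \<open>eval_nf\<close> bring the result into the required
    form.\<close>
  also have "?r = eval_t Var idn ?r"
    by (simp add: eval_Var_idn expl_free_subst expl_free_eval)
  also have "\<dots> = eval_t Var idn (ESub t u)"
    by (auto simp: eval_subst eval_nf drop_idx_def fun_eq_iff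
        intro!: arg_cong2[of _ _ _ _ "\<lambda>f g. eval_t f g _"] split: nat.split)
  finally show ?case .
next
  case (ERepl c a s)
  let ?r = "repl_c 0 a (map (eval_t Var idn) s) (eval_c Var idn c)"
  have "red_s\<^sup>*\<^sup>* s (map (eval_t Var idn) s)"
    using ERepl(2) by (auto intro!: reds_stack simp: list.rel_map list.rel_refl_strong)
  then have "red_c\<^sup>*\<^sup>* (ERepl c a s) ?r"
    using reds_ERepl[OF ERepl(1)] by (auto intro: R rtranclp.rtrancl_into_rtrancl)
  also have "?r = eval_c Var idn ?r"
    by (simp add: eval_Var_idn expl_free_repl expl_free_eval list.pred_map list.pred_True o_def)
  also have "\<dots> = eval_c Var idn (ERepl c a s)"
    by (auto simp: eval_repl eval_nf drop_idx_def fun_eq_iff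
        intro!: arg_cong2[of _ _ _ _ "\<lambda>f g. eval_c f g _"] split: nat.split)
  finally show ?case .
qed (auto intro: reds_App reds_Lam reds_Mu reds_Named)

lemma reds_OTrm: "red_t\<^sup>*\<^sup>* t t' \<Longrightarrow> OTrm t \<rightarrow>\<^sup>*\<^sub>\<Lambda>\<^sub>M OTrm t'"
  by (erule rtranclp_induct; auto intro: red.intros rtranclp.intros)

lemma reds_OCmd: "red_c\<^sup>*\<^sup>* c c' \<Longrightarrow> OCmd c \<rightarrow>\<^sup>*\<^sub>\<Lambda>\<^sub>M OCmd c'"
  by (erule rtranclp_induct; auto intro: red.intros rtranclp.intros)

lemma reds_OStk: "list_all2 red_t\<^sup>*\<^sup>* s s' \<Longrightarrow> OStk s \<rightarrow>\<^sup>*\<^sub>\<Lambda>\<^sub>M OStk s'"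
  by (drule reds_stack, erule rtranclp_induct; auto intro: red.intros rtranclp.intros)

lemma reds_nf: "p \<rightarrow>\<^sup>*\<^sub>\<Lambda>\<^sub>M nf p"
  by (cases p) (auto simp: list.rel_map intro!: reds_OTrm reds_OCmd reds_OStk reds_nf_t_c list.rel_refl_strong)

text \<open>A contraction is simulated by \<open>B\<close> or \<open>M\<close> with the empty
  context, followed by carrying out the new explicit operator.\<close>

lemma par_reds_t_c:
  "par_t t t' \<Longrightarrow> red_t\<^sup>*\<^sup>* t t'"
  "par_c c c' \<Longrightarrow> red_c\<^sup>*\<^sup>* c c'"
proof (induct rule: par_t_par_c.inducts)
  case (Beta t t' u u')
  have "red_t\<^sup>*\<^sup>* (App (Lam t) u) (App (Lam t') u')"
    using Beta by (intro reds_App reds_Lam)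
  also have "red_t (App (Lam t') u') (ESub t' u')"
    using B[of Hole] by simp
  also have "red_t\<^sup>*\<^sup>* (ESub t' u') (eval_t Var idn (ESub t' u'))"
    by (rule reds_nf_t_c)
  \<comment> \<open>Since \<open>u'\<close> is explicit-free, it is its own value, and evaluating
    \<open>ESub t' u'\<close> is the definition of \<open>inst u' t'\<close>.\<close>
  also have "\<dots> = inst u' t'"
    using par_expl_free(1)[OF Beta(3)] by (simp add: inst_def eval_Var_idn)
  finally show ?case .
next
  case (Struct c c' u u')
  let ?r = "Mu (ERepl (nlift_c 1 c') 0 [nlift_t 0 u'])"
  have "red_t\<^sup>*\<^sup>* (App (Mu c) u) (App (Mu c') u')"
    using Struct by (intro reds_App reds_Mu)
  also have "red_t (App (Mu c') u') ?r"
    using M[of Hole] by simp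
  also have "red_t\<^sup>*\<^sup>* ?r (eval_t Var idn ?r)"
    by (rule reds_nf_t_c)
  also have "\<dots> = Mu (minst u' c')"
    using par_expl_free(1)[OF Struct(3)] by (simp add: minst_def eval_Var_idn eval_nlift(2))
  finally show ?case .
qed (auto intro: reds_App reds_Lam reds_Mu reds_Named)

lemma par_reds: "par p q \<Longrightarrow> p \<rightarrow>\<^sup>*\<^sub>\<Lambda>\<^sub>M q"
  by (induct rule: par.induct)
    (auto intro!: reds_OTrm reds_OCmd reds_OStk par_reds_t_c elim: list.rel_mono_strong)

lemma pars_reds: "par\<^sup>*\<^sup>* p q \<Longrightarrow> p \<rightarrow>\<^sup>*\<^sub>\<Lambda>\<^sub>M q"
  by (induct rule: rtranclp_induct) (auto dest: par_reds)

lemma reds_pars_nf: "p \<rightarrow>\<^sup>*\<^sub>\<Lambda>\<^sub>M q \<Longrightarrow> par\<^sup>*\<^sup>* (nf p) (nf q)"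
  by (induct rule: rtranclp_induct) (auto dest: red_par_nf)

theorem theorem5:
  fixes p p\<^sub>1 p\<^sub>2 :: obj
  assumes "p \<rightarrow>\<^sup>*\<^sub>\<Lambda>\<^sub>M p\<^sub>1" and "p \<rightarrow>\<^sup>*\<^sub>\<Lambda>\<^sub>M p\<^sub>2"
  shows "\<exists>p\<^sub>3. p\<^sub>1 \<rightarrow>\<^sup>*\<^sub>\<Lambda>\<^sub>M p\<^sub>3 \<and> p\<^sub>2 \<rightarrow>\<^sup>*\<^sub>\<Lambda>\<^sub>M p\<^sub>3"
proof -
  \<comment> \<open>The fork at \<open>p\<close> is transferred to one at \<open>nf p\<close>, where
    \<open>par\<close> is confluent.\<close>
  obtain q where "par\<^sup>*\<^sup>* (nf p\<^sub>1) q" "par\<^sup>*\<^sup>* (nf p\<^sub>2) q"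
    using confluentpD[OF confluentp_par reds_pars_nf[OF assms(1)] reds_pars_nf[OF assms(2)]] by blast
  then have "nf p\<^sub>1 \<rightarrow>\<^sup>*\<^sub>\<Lambda>\<^sub>M q" "nf p\<^sub>2 \<rightarrow>\<^sup>*\<^sub>\<Lambda>\<^sub>M q"
    by (auto dest: pars_reds)
  then show ?thesis
    using reds_nf[of p\<^sub>1] reds_nf[of p\<^sub>2] by (meson rtranclp_trans)
qed

end
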